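(* Let $V_{\mathrm{sub}}\subset\mathbb{R}^q$ be the finite set of vectors generating the tangent cone of the convex support of a natural affine submodel at the observed value of its natural statistic, and let $$L_{\mathrm{sub}}=\{w\in V_{\mathrm{sub}}:-w\in\mathrm{con}(\mathrm{pos}\,V_{\mathrm{sub}})\}$$ be its linearity. A vector $w\in V_{\mathrm{sub}}$ is in $L_{\mathrm{sub}}$ if and only if the optimal value of the linear program $$\text{maximize }\langle w,\delta\rangle\quad\text{subject to}\quad\langle v,\delta\rangle\ge 0\ \text{ for all } v\in V_{\mathrm{sub}}\setminus\{w\},$$ with state vector $\delta\in\mathbb{R}^q$, is nonpositive.
   Context: For a finite set $V$, $\mathrm{con}(\mathrm{pos}\,V)$ is the set of all linear combinations of elements of $V$ with nonnegative coefficients ($\{0\}$ if $V$ is empty). $\langle v,\delta\rangle=\sum_i v_i\delta_i$. The optimal value of the linear program is the supremum of the objective over the feasible set (possibly $+\infty$). Setting: a saturated full exponential family has natural statistic $Y$ in $\mathbb{R}^p$, polyhedral convex support $C_{\mathrm{sat}}$ (the smallest closed convex set containing $Y$ with probability one), and observed value $y\in C_{\mathrm{sat}}$; a natural affine submodel is parametrized by $\theta=a+M\beta$ with $a\in\mathbb{R}^p$ a known vector and $M$ a known $p\times q$ matrix, and is an exponential family with natural statistic $M^TY$, natural parameter $\beta$, and convex support $C_{\mathrm{sub}}\subset\mathbb{R}^q$ (the convex support of $M^TY$). For a convex set $C$ and $x\in C$ the tangent cone is $T_C(x)=\mathrm{cl}\{s(w-x):w\in C,\ s\ge 0\}$. One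 has a finite set $V_{\mathrm{sat}}\subset\mathbb{R}^p$ with $T_{C_{\mathrm{sat}}}(y)=\mathrm{con}(\mathrm{pos}\,V_{\mathrm{sat}})$, and $V_{\mathrm{sub}}=\{M^Tv:v\in V_{\mathrm{sat}}\}$, for which $T_{C_{\mathrm{sub}}}(M^Ty)=\mathrm{con}(\mathrm{pos}\,V_{\mathrm{sub}})$. *)

theory Defs
  imports "HOL-Probability.Probability"
begin

text \<open>
  The family is generated by a measure \<open>lam\<close> on the sample space and a natural statistic \<open>Y\<close>.
  Its members have density \<open>exp (\<langle>Y, \<theta>\<rangle> - c(\<theta>))\<close> with respect to \<open>lam\<close>, where \<open>c\<close> is the
  cumulant function.
\<close>

definition laplace :: "'w measure \<Rightarrow> ('w \<Rightarrow> 'v::euclidean_space) \<Rightarrow> 'v \<Rightarrow> ennreal" where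
  "laplace lam Y \<theta> = (\<integral>\<^sup>+ \<omega>. ennreal (exp (Y \<omega> \<bullet> \<theta>)) \<partial>lam)"

definition full_parameter_space :: "'w measure \<Rightarrow> ('w \<Rightarrow> 'v::euclidean_space) \<Rightarrow> 'v set" where
  "full_parameter_space lam Y = {\<theta>. laplace lam Y \<theta> < \<infinity>}"

definition cumulant :: "'w measure \<Rightarrow> ('w \<Rightarrow> 'v::euclidean_space) \<Rightarrow> 'v \<Rightarrow> real" where
  "cumulant lam Y \<theta> = ln (enn2real (laplace lam Y \<theta>))"

definition exp_family_measure ::
    "'w measure \<Rightarrow> ('w \<Rightarrow> 'v::euclidean_space) \<Rightarrow> 'v \<Rightarrow> 'w measure" where
  "exp_family_measure lam Y \<theta> =
     density lam (\<lambda>\<omega>. ennreal (exp (Y \<omega> \<bullet> \<theta> - cumulant lam Y \<theta>)))"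

definition full_exp_family ::
    "'w measure \<Rightarrow> ('w \<Rightarrow> 'v::euclidean_space) \<Rightarrow> 'w measure set" where
  "full_exp_family lam Y = exp_family_measure lam Y ` full_parameter_space lam Y"

text \<open>
  A nonzero generating measure and a nonempty parameter space are exactly what makes the family a
  nonempty set of probability measures.
\<close>

definition generates_full_exp_family ::
    "'w measure \<Rightarrow> ('w \<Rightarrow> 'v::euclidean_space) \<Rightarrow> bool" where
  "generates_full_exp_family lam Y \<longleftrightarrow>
     Y \<in> borel_measurable lam \<and> emeasure lam (space lam) \<noteq> 0 \<and> full_parameter_space lam Y \<noteq> {}"

definition natural_affine_submodel ::
    "'w measure \<Rightarrow> ('w \<Rightarrow> real ^ 'p) \<Rightarrow> real ^ 'p \<Rightarrow> real ^ 'q ^ 'p \<Rightarrow> 'w measure set" where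
  "natural_affine_submodel lam Y a M =
     {exp_family_measure lam Y (a + M *v \<beta>) | \<beta>. a + M *v \<beta> \<in> full_parameter_space lam Y}"

lemma prob_space_exp_family_measure:
  assumes "generates_full_exp_family lam Y" and "\<theta> \<in> full_parameter_space lam Y"
  shows "prob_space (exp_family_measure lam Y \<theta>)"
proof
  have [measurable]: "Y \<in> borel_measurable lam"
    and nz: "emeasure lam (space lam) \<noteq> 0"
    using assms(1) by (auto simp: generates_full_exp_family_def)
  let ?Z = "laplace lam Y \<theta>"
  have fin: "?Z < \<infinity>" using assms(2) by (simp add: full_parameter_space_def)
  have "?Z \<noteq> 0"
  proof
    assume "?Z = 0"
    then have "AE \<omega> in lam. ennreal (exp (Y \<omega> \<bullet> \<theta>)) = 0"
      unfolding laplace_def by (subst (asm) nn_integral_0_iff_AE) auto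
    then have "AE \<omega> in lam. False" by (auto simp: ennreal_eq_0_iff not_le)
    then show False using nz by (simp add: ae_filter_eq_bot_iff trivial_limit_def[symmetric])
  qed
  then have pos: "enn2real ?Z > 0" using fin by (simp add: enn2real_positive_iff zero_less_iff_neq_zero)
  have "emeasure (exp_family_measure lam Y \<theta>) (space (exp_family_measure lam Y \<theta>)) =
      (\<integral>\<^sup>+ \<omega>. ennreal (exp (Y \<omega> \<bullet> \<theta>)) * ennreal (inverse (enn2real ?Z)) \<partial>lam)"
    unfolding exp_family_measure_def cumulant_def
    by (subst emeasure_density)
       (auto intro!: nn_integral_cong simp: exp_diff pos divide_inverse ennreal_mult)
  also have "\<dots> = ?Z * ennreal (inverse (enn2real ?Z))"
    unfolding laplace_def by (subst nn_integral_multc) auto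
  also have "\<dots> = ennreal (enn2real ?Z) * ennreal (inverse (enn2real ?Z))"
    using fin by simp
  also have "\<dots> = 1" using pos by (simp flip: ennreal_mult)
  finally show "emeasure (exp_family_measure lam Y \<theta>) (space (exp_family_measure lam Y \<theta>)) = 1" .
qed

text \<open>
  The submodel is itself the full exponential family with natural statistic \<open>M\<^sup>T Y\<close> and natural
  parameter \<open>\<beta>\<close>, the factor \<open>exp \<langle>Y, a\<rangle>\<close> being absorbed in the generating measure.
\<close>

lemma natural_affine_submodel_eq_full_exp_family:
  fixes Y :: "'w \<Rightarrow> real ^ 'p" and M :: "real ^ 'q ^ 'p"
  assumes [measurable]: "Y \<in> borel_measurable lam"
  shows "natural_affine_submodel lam Y a M =
    full_exp_family (density lam (\<lambda>\<omega>. ennreal (exp (Y \<omega> \<bullet> a)))) (\<lambda>\<omega>. transpose M *v Y \<omega>)"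
proof -
  let ?lam = "density lam (\<lambda>\<omega>. ennreal (exp (Y \<omega> \<bullet> a)))"
  let ?Y = "\<lambda>\<omega>. transpose M *v Y \<omega>"
  have inner: "?Y \<omega> \<bullet> \<beta> = Y \<omega> \<bullet> (M *v \<beta>)" for \<omega> \<beta>
    by (simp add: dot_lmul_matrix)
  have meas [measurable]: "?Y \<in> borel_measurable lam"
    by (rule borel_measurable_continuous_on [OF _ assms])
       (rule linear_continuous_on, rule matrix_vector_mul_bounded_linear)
  have lap: "laplace ?lam ?Y \<beta> = laplace lam Y (a + M *v \<beta>)" for \<beta>
    unfolding laplace_def inner
    by (subst nn_integral_density) (auto simp: inner_add_right exp_add ennreal_mult)
  have mem: "exp_family_measure ?lam ?Y \<beta> = exp_family_measure lam Y (a + M *v \<beta>)" for \<beta>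
    unfolding exp_family_measure_def cumulant_def lap inner
    by (subst density_density_eq)
       (auto simp: inner_add_right ennreal_mult [symmetric] exp_add [symmetric] algebra_simps)
  show ?thesis
    unfolding natural_affine_submodel_def full_exp_family_def full_parameter_space_def
      mem lap by blast
qed

text \<open>
  The convex support is a property of the whole model: the members of an exponential family have
  everywhere positive densities with respect to each other, so they all have the same null sets.
\<close>

definition is_convex_support ::
    "'w measure set \<Rightarrow> ('w \<Rightarrow> 'v::euclidean_space) \<Rightarrow> 'v set \<Rightarrow> bool" where
  "is_convex_support \<P> Y C \<longleftrightarrow>
     closed C \<and> convex C \<and> (\<forall>P\<in>\<P>. AE \<omega> in P. Y \<omega> \<in> C) \<and>
     (\<forall>D. closed D \<and> convex D \<and> (\<forall>P\<in>\<P>. AE \<omega> in P. Y \<omega> \<in> D) \<longrightarrow> C \<subseteq> D)"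

definition tangent_cone :: "'v::euclidean_space set \<Rightarrow> 'v \<Rightarrow> 'v set" where
  "tangent_cone C x = closure {s *\<^sub>R (w - x) | w s. w \<in> C \<and> 0 \<le> s}"

text \<open>Meaningful for finite \<open>V\<close> only.\<close>

definition con_pos :: "'v::euclidean_space set \<Rightarrow> 'v set" where
  "con_pos V = {\<Sum>v\<in>V. c v *\<^sub>R v | c. \<forall>v\<in>V. 0 \<le> c v}"

definition linearity :: "'v::euclidean_space set \<Rightarrow> 'v set" where
  "linearity V = {w \<in> V. - w \<in> con_pos V}"

definition lp_feasible :: "'v::euclidean_space \<Rightarrow> 'v set \<Rightarrow> 'v set" where
  "lp_feasible w V = {\<delta>. \<forall>v \<in> V - {w}. 0 \<le> v \<bullet> \<delta>}"

definition lp_optimal_value :: "'v::euclidean_space \<Rightarrow> 'v set \<Rightarrow> ereal" where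
  "lp_optimal_value w V = (SUP \<delta> \<in> lp_feasible w V. ereal (w \<bullet> \<delta>))"

end

theory Submission imports Defs begin

text \<open>
  The claim is Farkas' lemma applied to the generators other than \<open>w\<close>. If \<open>-w\<close> is a nonnegative
  combination of all generators, the coefficient \<open>c\<close> of \<open>w\<close> itself can be moved to the other side:
  \<open>-(1 + c) w\<close> is a nonnegative combination of the remaining generators, hence so is \<open>-w\<close>.
  So \<open>w\<close> lies in the linearity exactly when \<open>-w\<close> belongs to the cone generated by \<open>V - {w}\<close>
  (\<open>mem_linearity_iff\<close>), and by Farkas' lemma (\<open>mem_con_pos_iff\<close>) this means that \<open>-w\<close> has
  nonnegative inner product with every \<open>\<delta>\<close> that has nonnegative inner product with all of
  \<open>V - {w}\<close>. Those \<open>\<delta>\<close> are the feasible points of the linear program, so the condition says that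
  its objective is nowhere positive on the feasible set.
\<close>

lemma convex_cone_con_pos: "convex_cone (con_pos V)"
  unfolding convex_cone_iff
proof (intro conjI ballI allI impI)
  show "0 \<in> con_pos V"
    unfolding con_pos_def by (auto intro!: exI[of _ "\<lambda>_. 0"])
next
  fix x y assume "x \<in> con_pos V" "y \<in> con_pos V"
  then obtain c d where "x = (\<Sum>v\<in>V. c v *\<^sub>R v)" "\<forall>v\<in>V. 0 \<le> c v"
    "y = (\<Sum>v\<in>V. d v *\<^sub>R v)" "\<forall>v\<in>V. 0 \<le> d v"
    unfolding con_pos_def by auto
  then show "x + y \<in> con_pos V"
    unfolding con_pos_def
    by (auto intro!: exI[of _ "\<lambda>v. c v + d v"] simp: scaleR_add_left sum.distrib)
next
  fix x and s :: real assume "x \<in> con_pos V" "0 \<le> s"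
  then obtain c where "x = (\<Sum>v\<in>V. c v *\<^sub>R v)" "\<forall>v\<in>V. 0 \<le> c v"
    unfolding con_pos_def by auto
  with \<open>0 \<le> s\<close> show "s *\<^sub>R x \<in> con_pos V"
    unfolding con_pos_def by (auto intro!: exI[of _ "\<lambda>v. s * c v"] simp: scaleR_sum_right)
qed

lemma subset_con_pos:
  assumes "finite V"
  shows "V \<subseteq> con_pos V"
proof
  fix u assume u: "u \<in> V"
  have "(\<Sum>v\<in>V. (if v = u then 1 else 0) *\<^sub>R v) = (\<Sum>v\<in>V. if v = u then v else 0)"
    by (intro sum.cong) auto
  also have "\<dots> = u"
    using assms u by simp
  finally show "u \<in> con_pos V"
    unfolding con_pos_def by (intro CollectI exI[of _ "\<lambda>v. if v = u then 1 else 0"]) auto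
qed

text \<open>
  Identifying \<open>con_pos V\<close> with a convex cone hull makes it closed, since finitely generated convex
  cones are polyhedra; closedness is what allows strict separation in Farkas' lemma.
\<close>

lemma con_pos_eq_convex_cone_hull:
  assumes "finite V"
  shows "con_pos V = convex_cone hull V"
proof
  show "convex_cone hull V \<subseteq> con_pos V"
    using assms by (intro hull_minimal subset_con_pos convex_cone_con_pos)
  have "(\<Sum>v\<in>F. c v *\<^sub>R v) \<in> convex_cone hull V" if "F \<subseteq> V" "\<forall>v\<in>F. 0 \<le> c v" for F c
    using finite_subset[OF that(1) assms] that
    by (induction F rule: finite_induct)
       (auto intro!: convex_cone_hull_add convex_cone_hull_mul
          simp: convex_cone_hull_contains_0 hull_inc)
  then show "con_pos V \<subseteq> convex_cone hull V"
    unfolding con_pos_def by auto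
qed

lemma inner_nonneg_con_pos:
  assumes "z \<in> con_pos V" and "\<forall>v\<in>V. 0 \<le> v \<bullet> \<delta>"
  shows "0 \<le> z \<bullet> \<delta>"
  using assms unfolding con_pos_def by (auto simp: inner_sum_left intro!: sum_nonneg)

text \<open>
  Farkas' lemma. A point outside the closed cone is strictly separated from it by a hyperplane
  \<open>\<delta> \<bullet> x = b\<close>; because the cone contains \<open>0\<close> the level \<open>b\<close> is negative, and because it is stable
  under scaling the functional \<open>\<delta>\<close> cannot take a negative value on it.
\<close>

lemma mem_con_pos_iff:
  assumes "finite V"
  shows "z \<in> con_pos V \<longleftrightarrow> (\<forall>\<delta>. (\<forall>v\<in>V. 0 \<le> v \<bullet> \<delta>) \<longrightarrow> 0 \<le> z \<bullet> \<delta>)"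
proof
  assume "z \<in> con_pos V"
  then show "\<forall>\<delta>. (\<forall>v\<in>V. 0 \<le> v \<bullet> \<delta>) \<longrightarrow> 0 \<le> z \<bullet> \<delta>"
    using inner_nonneg_con_pos by blast
next
  assume dual: "\<forall>\<delta>. (\<forall>v\<in>V. 0 \<le> v \<bullet> \<delta>) \<longrightarrow> 0 \<le> z \<bullet> \<delta>"
  show "z \<in> con_pos V"
  proof (rule ccontr)
    assume "z \<notin> con_pos V"
    then have "z \<notin> convex_cone hull V"
      using assms by (simp add: con_pos_eq_convex_cone_hull)
    then obtain \<delta> b where z: "\<delta> \<bullet> z < b" and sep: "\<forall>x\<in>convex_cone hull V. b < \<delta> \<bullet> x"
      using separating_hyperplane_closed_point[OF convex_convex_cone_hull]
        closed_convex_cone_hull[OF assms] by blast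
    have b: "b < 0"
      using sep convex_cone_hull_contains_0[of V] by force
    have "0 \<le> v \<bullet> \<delta>" if "v \<in> V" for v
    proof (rule ccontr)
      assume "\<not> 0 \<le> v \<bullet> \<delta>"
      then have neg: "\<delta> \<bullet> v < 0"
        by (simp add: inner_commute)
      \<comment> \<open>The multiple of \<open>v\<close> that lies on the separating hyperplane.\<close>
      have "(b / (\<delta> \<bullet> v)) *\<^sub>R v \<in> convex_cone hull V"
        using that b neg by (intro convex_cone_hull_mul hull_inc divide_nonpos_nonpos) auto
      then have "b < \<delta> \<bullet> ((b / (\<delta> \<bullet> v)) *\<^sub>R v)"
        using sep by blast
      then show False
        using neg by simp
    qed
    then have "0 \<le> z \<bullet> \<delta>"
      using dual by blast
    then show False
      using z b by (simp add: inner_commute)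
  qed
qed

text \<open>
  The generator \<open>w\<close> is of no help in representing \<open>-w\<close>: if it occurs with coefficient \<open>c\<close>, then
  the other terms sum to \<open>-(1 + c) w\<close>, and dividing by \<open>1 + c > 0\<close> leaves a representation
  without \<open>w\<close>. This is why the linear program may leave out the constraint belonging to \<open>w\<close>.
\<close>

lemma mem_linearity_iff:
  assumes "finite V" and "w \<in> V"
  shows "w \<in> linearity V \<longleftrightarrow> - w \<in> con_pos (V - {w})"
proof
  assume "w \<in> linearity V"
  then obtain c where eq: "- w = (\<Sum>v\<in>V. c v *\<^sub>R v)" and c: "\<forall>v\<in>V. 0 \<le> c v"
    unfolding linearity_def con_pos_def by auto
  define r where "r = (\<Sum>v\<in>V - {w}. c v *\<^sub>R v)"
  have pos: "0 < 1 + c w"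
    using c assms(2) by (simp add: add_pos_nonneg)
  have "- w = c w *\<^sub>R w + r"
    unfolding eq r_def using assms by (rule sum.remove)
  then have "r = - w - c w *\<^sub>R w"
    by (metis add_diff_cancel_left')
  then have r: "r = (1 + c w) *\<^sub>R (- w)"
    by (simp add: scaleR_add_left)
  have "r \<in> con_pos (V - {w})"
    using c unfolding r_def con_pos_def by auto
  then have "inverse (1 + c w) *\<^sub>R r \<in> con_pos (V - {w})"
    using pos by (intro convex_cone_scaleR[OF convex_cone_con_pos]) auto
  then show "- w \<in> con_pos (V - {w})"
    using pos by (simp add: r)
next
  assume "- w \<in> con_pos (V - {w})"
  moreover have "con_pos (V - {w}) \<subseteq> con_pos V"
    using assms(1) by (simp add: con_pos_eq_convex_cone_hull hull_mono)
  ultimately show "w \<in> linearity V"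
    using assms(2) unfolding linearity_def by auto
qed

lemma lp_optimal_value_nonpos_iff:
  "lp_optimal_value w V \<le> 0 \<longleftrightarrow> (\<forall>\<delta>. (\<forall>v\<in>V - {w}. 0 \<le> v \<bullet> \<delta>) \<longrightarrow> w \<bullet> \<delta> \<le> 0)"
  unfolding lp_optimal_value_def lp_feasible_def by (auto simp: SUP_le_iff)

theorem theorem10:
  fixes lam :: "'w measure"
    and Y :: "'w \<Rightarrow> real ^ 'p"
    and a y :: "real ^ 'p"
    and M :: "real ^ 'q ^ 'p"
    and C_sat V_sat :: "(real ^ 'p) set"
    and C_sub V_sub :: "(real ^ 'q) set"
    and w :: "real ^ 'q"
  assumes "generates_full_exp_family lam Y"
    and "is_convex_support (full_exp_family lam Y) Y C_sat"
    and "polyhedron C_sat"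
    and "y \<in> C_sat"
    and "natural_affine_submodel lam Y a M \<noteq> {}"
    and "is_convex_support (natural_affine_submodel lam Y a M) (\<lambda>\<omega>. transpose M *v Y \<omega>) C_sub"
    and "finite V_sat"
    and "tangent_cone C_sat y = con_pos V_sat"
    and "V_sub = (\<lambda>v. transpose M *v v) ` V_sat"
    and "tangent_cone C_sub (transpose M *v y) = con_pos V_sub"
    and "w \<in> V_sub"
  shows "w \<in> linearity V_sub \<longleftrightarrow> lp_optimal_value w V_sub \<le> 0"
proof -
  have "finite V_sub"
    using assms(7,9) by simp
  then show ?thesis
    using \<open>w \<in> V_sub\<close>
    by (simp add: mem_linearity_iff mem_con_pos_iff lp_optimal_value_nonpos_iff)
qed

end
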